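(* It holds that $\mathcal C\star\mathcal C_b\subset\mathcal C$; that is, if $\sigma_1\in\mathcal C$ and $\sigma_2\in\mathcal C_b$, then the convolution $\sigma_1\star\sigma_2$ belongs to $\mathcal C$.
   Context: $\mathcal C$ is the set of positive regular Borel measures $\sigma$ on $\mathbb R^n$ such that $\int_{\mathbb R^n}\frac{d\sigma(u)}{(1+|u|^2)^p}<\infty$ for some $p\in\mathbb N$. $\mathcal C_b$ is the set of positive Borel measures $\sigma$ on $\mathbb R^n$ such that for every $p\in\mathbb N$ there exist $q\in\mathbb N$ and $C_{pq}>0$ such that $\int_{\mathbb R^n}\frac{d\sigma(u)}{(1+|u+v|^2)^q}\le\frac{C_{pq}}{(1+|v|^2)^p}$ for all $v\in\mathbb R^n$. The convolution is defined by $\int_{\mathbb R^n}f\,d(\sigma_1\star\sigma_2)=\iint_{\mathbb R^n\times\mathbb R^n}f(u+v)\,d\sigma_1(u)\,d\sigma_2(v)$ for nonnegative Borel functions $f$. *)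

theory Defs
  imports "HOL-Probability.Convolution" "HOL-Analysis.Cartesian_Euclidean_Space"
begin

text \<open>Local finiteness is not part of regularity here; in the class below it follows from the integral
  condition.\<close>

definition regular_borel_measure :: "'a::topological_space measure \<Rightarrow> bool" where
  "regular_borel_measure M \<longleftrightarrow>
     sets M = sets borel \<and>
     (\<forall>A\<in>sets borel.
        emeasure M A = (INF U\<in>{U. open U \<and> A \<subseteq> U}. emeasure M U) \<and>
        emeasure M A = (SUP K\<in>{K. compact K \<and> K \<subseteq> A}. emeasure M K))"

definition class_C :: "(real ^ 'n) measure set" where
  "class_C = {\<sigma>. regular_borel_measure \<sigma> \<and>
     (\<exists>p::nat. (\<integral>\<^sup>+u. ennreal (1 / (1 + (norm u)\<^sup>2) ^ p) \<partial>\<sigma>) < \<infinity>)}"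

definition class_Cb :: "(real ^ 'n) measure set" where
  "class_Cb = {\<sigma>. sets \<sigma> = sets borel \<and>
     (\<forall>p::nat. \<exists>q::nat. \<exists>C::real. C > 0 \<and>
        (\<forall>v. (\<integral>\<^sup>+u. ennreal (1 / (1 + (norm (u + v))\<^sup>2) ^ q) \<partial>\<sigma>)
               \<le> ennreal (C / (1 + (norm v)\<^sup>2) ^ p)))}"

text \<open>The convolution is the library's \<^const>\<open>convolution\<close>, the image of the product measure under addition.
  The library relates it to iterated integrals only for finite measures. The lemmas below show that,
  for the possibly infinite measures of the two classes, it is still the measure defined by
  \<open>\<integral> f d(\<sigma>1 \<star> \<sigma>2) = \<integral>\<integral> f(u + v) d\<sigma>1(u) d\<sigma>2(v)\<close>, and that this identity determines it.\<close>

lemma sigma_finite_if_moment: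
  fixes M :: "(real ^ 'n) measure"
  assumes sM: "sets M = sets borel"
    and fin: "(\<integral>\<^sup>+u. ennreal (1 / (1 + (norm u)\<^sup>2) ^ p) \<partial>M) < \<infinity>"
  shows "sigma_finite_measure M"
proof (unfold_locales, intro exI conjI)
  let ?A = "range (\<lambda>n::nat. cball (0::real^'n) (real n))"
  note [measurable_cong] = sM
  show "countable ?A" by simp
  show "?A \<subseteq> sets M" by (auto simp: sM)
  have "\<Union>?A = UNIV"
    by (auto simp: real_arch_simple)
  then show "\<Union>?A = space M"
    using sets_eq_imp_space_eq[OF sM] by simp
  show "\<forall>a\<in>?A. emeasure M a \<noteq> \<infinity>"
  proof clarify
    fix n :: nat
    assume inf: "emeasure M (cball 0 (real n)) = \<infinity>"
    define c where "c = 1 / (1 + (real n)\<^sup>2) ^ p"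
    have c: "c > 0"
      unfolding c_def by (intro divide_pos_pos zero_less_power add_pos_nonneg) auto
    have "ennreal c * emeasure M (cball 0 (real n))
        = (\<integral>\<^sup>+u. ennreal c * indicator (cball 0 (real n)) u \<partial>M)"
      by (subst nn_integral_cmult_indicator) (auto simp: sM)
    also have "\<dots> \<le> (\<integral>\<^sup>+u. ennreal (1 / (1 + (norm u)\<^sup>2) ^ p) \<partial>M)"
    proof (rule nn_integral_mono)
      fix u :: "real^'n"
      have "c \<le> 1 / (1 + (norm u)\<^sup>2) ^ p" if "norm u \<le> real n"
        unfolding c_def
        by (intro divide_left_mono power_mono add_left_mono mult_pos_pos zero_less_power
            add_pos_nonneg that) auto
      then show "ennreal c * indicator (cball 0 (real n)) u \<le> ennreal (1 / (1 + (norm u)\<^sup>2) ^ p)"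
        by (auto simp: indicator_def intro!: ennreal_leI)
    qed
    finally have "ennreal c * emeasure M (cball 0 (real n)) < \<infinity>"
      using fin by simp
    then show False
      using inf c by (simp add: ennreal_mult_top)
  qed
qed

lemma sigma_finite_class_C: "\<sigma> \<in> class_C \<Longrightarrow> sigma_finite_measure \<sigma>"
  by (auto simp: class_C_def regular_borel_measure_def intro: sigma_finite_if_moment)

lemma sigma_finite_class_Cb:
  assumes "\<sigma> \<in> class_Cb"
  shows "sigma_finite_measure \<sigma>"
proof -
  obtain q :: nat and C :: real where
    "\<forall>v. (\<integral>\<^sup>+u. ennreal (1 / (1 + (norm (u + v))\<^sup>2) ^ q) \<partial>\<sigma>) \<le> ennreal (C / (1 + (norm v)\<^sup>2) ^ 0)"
    using assms unfolding class_Cb_def by blast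
  from this[rule_format, of 0]
  have "(\<integral>\<^sup>+u. ennreal (1 / (1 + (norm u)\<^sup>2) ^ q) \<partial>\<sigma>) < \<infinity>"
    by (auto simp: less_top[symmetric] top_unique)
  then show ?thesis
    using assms by (intro sigma_finite_if_moment) (auto simp: class_Cb_def)
qed

lemma nn_integral_convolution_class:
  fixes f :: "real ^ 'n \<Rightarrow> ennreal"
  assumes 1: "\<sigma>1 \<in> class_C" and 2: "\<sigma>2 \<in> class_Cb"
    and f[measurable]: "f \<in> borel_measurable borel"
  shows "(\<integral>\<^sup>+x. f x \<partial>(\<sigma>1 \<star> \<sigma>2)) = (\<integral>\<^sup>+v. (\<integral>\<^sup>+u. f (u + v) \<partial>\<sigma>1) \<partial>\<sigma>2)"
proof -
  have [measurable_cong]: "sets \<sigma>1 = sets borel" "sets \<sigma>2 = sets borel"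
    using 1 2 by (auto simp: class_C_def class_Cb_def regular_borel_measure_def)
  interpret S1: sigma_finite_measure \<sigma>1 by (rule sigma_finite_class_C[OF 1])
  interpret S2: sigma_finite_measure \<sigma>2 by (rule sigma_finite_class_Cb[OF 2])
  interpret pair_sigma_finite \<sigma>1 \<sigma>2 ..
  show ?thesis
    unfolding convolution_def
    by (simp add: nn_integral_distr nn_integral_snd[symmetric])
qed

lemma convolution_class_unique:
  fixes \<sigma>1 \<sigma>2 \<sigma> :: "(real ^ 'n) measure"
  assumes "\<sigma>1 \<in> class_C" "\<sigma>2 \<in> class_Cb" and s: "sets \<sigma> = sets borel"
    and eq: "\<And>f::real ^ 'n \<Rightarrow> ennreal. f \<in> borel_measurable borel \<Longrightarrow>
      (\<integral>\<^sup>+x. f x \<partial>\<sigma>) = (\<integral>\<^sup>+v. (\<integral>\<^sup>+u. f (u + v) \<partial>\<sigma>1) \<partial>\<sigma>2)"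
  shows "\<sigma> = (\<sigma>1 \<star> \<sigma>2)"
proof (rule measure_eqI)
  show "sets \<sigma> = sets (\<sigma>1 \<star> \<sigma>2)" by (simp add: s)
  fix A assume "A \<in> sets \<sigma>"
  then have A: "A \<in> sets borel" by (simp add: s)
  then have "(\<integral>\<^sup>+x. indicator A x \<partial>\<sigma>) = (\<integral>\<^sup>+x. indicator A x \<partial>(\<sigma>1 \<star> \<sigma>2))"
    by (subst eq, simp, subst nn_integral_convolution_class[OF assms(1,2)]) simp_all
  then show "emeasure \<sigma> A = emeasure (\<sigma>1 \<star> \<sigma>2) A"
    using A by (simp add: s)
qed

end

theory Submission
  imports Defs
begin

text \<open>
  Write \<open>w\<^sub>p(x) = 1 / (1 + |x|\<^sup>2)\<^sup>p\<close>. If \<open>\<sigma>1\<close> has a finite integral of \<open>w\<^sub>p\<close>, the defining property of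
  \<^const>\<open>class_Cb\<close> for this \<open>p\<close> provides \<open>q\<close> and \<open>C\<close> such that \<open>w\<^sub>q\<close>, averaged over the translates by
  \<open>\<sigma>2\<close>, is at most \<open>C w\<^sub>p\<close>. By Tonelli, the integral of \<open>w\<^sub>q\<close> against \<open>\<sigma>1 \<star> \<sigma>2\<close> is therefore at most
  \<open>C\<close> times the integral of \<open>w\<^sub>p\<close> against \<open>\<sigma>1\<close>.

  Regularity comes for free from this bound. The open sets on which \<open>w\<^sub>q\<close> exceeds
  \<open>1/n\<close> have finite measure and exhaust the space; finite Borel measures on a Polish space are regular,
  and regularity passes to a measure from its restrictions to such an exhausting sequence of open
  sets (\<open>regular_borel_measure_if_open_exhaustion\<close>).
\<close>

text \<open>Inner approximation is a double supremum, over the exhausting sets and over compact sets in each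
  of them. For outer approximation, a set is approximated inside the \<open>n\<close>-th exhausting set
  up to an error \<open>e / 2\<^sup>n\<^sup>+\<^sup>1\<close>; as the exhausting sets are open, the approximations are open in the whole
  space and can be united.\<close>

lemma regular_borel_measure_if_open_exhaustion:
  fixes M :: "'a::{second_countable_topology, complete_space} measure"
  assumes sM: "sets M = sets borel"
    and W: "\<And>n::nat. open (W n)" "incseq W" "(\<Union>n. W n) = UNIV"
    and fin: "\<And>n. emeasure M (W n) < \<infinity>"
  shows "regular_borel_measure M"
  unfolding regular_borel_measure_def
proof (intro conjI ballI)
  show "sets M = sets borel" by (rule sM)
next
  fix A :: "'a set"
  assume A: "A \<in> sets borel"
  have W_sets: "W n \<in> sets M" for n
    using W(1) by (simp add: sM)
  define N where "N n = density M (indicator (W n))" for n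
  have sN: "sets (N n) = sets borel" for n
    by (simp add: N_def sM)
  have N: "emeasure (N n) X = emeasure M (W n \<inter> X)" if "X \<in> sets borel" for n X
    unfolding N_def using W_sets that by (intro emeasure_restricted) (auto simp: sM)
  have N_fin: "emeasure (N n) (space (N n)) \<noteq> \<infinity>" for n
    using fin[of n] sets_eq_imp_space_eq[OF sN[of n]] by (simp add: N)

  show "emeasure M A = (SUP K\<in>{K. compact K \<and> K \<subseteq> A}. emeasure M K)"
  proof (rule antisym)
    have "emeasure M A = emeasure M (\<Union>n. W n \<inter> A)"
      using W(3) by (intro arg_cong[where f = "emeasure M"]) blast
    also have "\<dots> = (SUP n. emeasure M (W n \<inter> A))"
      using W(2) W_sets A
      by (intro SUP_emeasure_incseq[symmetric]) (fastforce simp: incseq_def sM)+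
    also have "\<dots> \<le> (SUP K\<in>{K. compact K \<and> K \<subseteq> A}. emeasure M K)"
    proof (rule SUP_least)
      fix n
      have "emeasure M (W n \<inter> A) = (SUP K\<in>{K. K \<subseteq> A \<and> compact K}. emeasure (N n) K)"
        using inner_regular[OF sN N_fin A] N[OF A] by simp
      also have "\<dots> \<le> (SUP K\<in>{K. compact K \<and> K \<subseteq> A}. emeasure M K)"
      proof (rule SUP_mono)
        fix K assume K: "K \<in> {K. K \<subseteq> A \<and> compact K}"
        then have "K \<in> sets borel" by (auto intro: borel_compact)
        then have "emeasure (N n) K \<le> emeasure M K"
          by (auto simp: N sM intro: emeasure_mono)
        with K show "\<exists>K'\<in>{K. compact K \<and> K \<subseteq> A}. emeasure (N n) K \<le> emeasure M K'"
          by blast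
      qed
      finally show "emeasure M (W n \<inter> A) \<le> (SUP K\<in>{K. compact K \<and> K \<subseteq> A}. emeasure M K)" .
    qed
    finally show "emeasure M A \<le> (SUP K\<in>{K. compact K \<and> K \<subseteq> A}. emeasure M K)" .
    show "(SUP K\<in>{K. compact K \<and> K \<subseteq> A}. emeasure M K) \<le> emeasure M A"
      using A by (intro SUP_least emeasure_mono) (auto simp: sM)
  qed

  show "emeasure M A = (INF U\<in>{U. open U \<and> A \<subseteq> U}. emeasure M U)"
  proof (rule antisym)
    show "emeasure M A \<le> (INF U\<in>{U. open U \<and> A \<subseteq> U}. emeasure M U)"
      by (intro INF_greatest emeasure_mono) (auto simp: sM)
    show "(INF U\<in>{U. open U \<and> A \<subseteq> U}. emeasure M U) \<le> emeasure M A"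
    proof (rule ennreal_le_epsilon)
      fix e :: real
      assume e: "0 < e"
      let ?e = "\<lambda>n. e * (1 / 2) ^ Suc n"
      have "\<exists>U. open U \<and> W n \<inter> A \<subseteq> U \<and> emeasure M (U - A) \<le> ennreal (?e n)" for n
      proof -
        have NA_fin: "emeasure (N n) A \<noteq> \<infinity>"
          using N_fin[of n] emeasure_space[of "N n" A] by (auto simp: top_unique)
        have "(INF U\<in>{U. A \<subseteq> U \<and> open U}. emeasure (N n) U) = emeasure (N n) A"
          by (rule outer_regular[OF sN N_fin A, symmetric])
        also have "\<dots> < emeasure (N n) A + ennreal (?e n)"
        proof -
          have "0 < ennreal (?e n)"
            using e by simp
          then have "emeasure (N n) A + 0 < emeasure (N n) A + ennreal (?e n)"
            using NA_fin unfolding ennreal_add_left_cancel_less by simp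
          then show ?thesis
            unfolding add_0_right .
        qed
        finally obtain U where U: "A \<subseteq> U" "open U"
          and le: "emeasure (N n) U < emeasure (N n) A + ennreal (?e n)"
          unfolding INF_less_iff by blast
        have "emeasure M ((W n \<inter> U) - A) = emeasure (N n) (U - A)"
          using U A by (simp add: N Int_Diff)
        also have "\<dots> = emeasure (N n) U - emeasure (N n) A"
          using U A NA_fin by (intro emeasure_Diff) (auto simp: sN)
        also have "\<dots> \<le> ennreal (?e n)"
          using le by (intro ennreal_minus_le_iff[THEN iffD2]) (auto simp: less_imp_le)
        finally show ?thesis
          using U W(1) by (intro exI[of _ "W n \<inter> U"]) auto
      qed
      then obtain U where U: "\<And>n. open (U n)" "\<And>n. W n \<inter> A \<subseteq> U n"
        and U_le: "\<And>n. emeasure M (U n - A) \<le> ennreal (?e n)"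
        by metis
      have U_sets: "U n - A \<in> sets M" for n
        using U(1) A by (auto simp: sM)
      have sub: "A \<subseteq> (\<Union>n. U n)"
      proof
        fix x assume "x \<in> A"
        moreover obtain n where "x \<in> W n"
          using W(3) by blast
        ultimately show "x \<in> (\<Union>n. U n)"
          using U(2)[of n] by blast
      qed
      have "emeasure M (\<Union>n. U n - A) \<le> (\<Sum>n. emeasure M (U n - A))"
        using U_sets by (intro emeasure_subadditive_countably) auto
      also have "\<dots> \<le> (\<Sum>n. ennreal (?e n))"
        using U_le by (intro suminf_le) auto
      also have "\<dots> = ennreal (e * 1)"
        using e by (intro suminf_ennreal_eq sums_mult power_half_series) auto
      finally have rest: "emeasure M (\<Union>n. U n - A) \<le> ennreal e" by simp
      have "(INF U\<in>{U. open U \<and> A \<subseteq> U}. emeasure M U) \<le> emeasure M (\<Union>n. U n)"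
        using U(1) sub by (intro INF_lower) auto
      also have "(\<Union>n. U n) = A \<union> (\<Union>n. U n - A)"
        using sub by blast
      also have "emeasure M \<dots> \<le> emeasure M A + emeasure M (\<Union>n. U n - A)"
        using A U_sets by (intro emeasure_subadditive) (auto simp: sM simp del: UN_simps)
      also have "\<dots> \<le> emeasure M A + ennreal e"
        using rest by (rule add_left_mono)
      finally show "(INF U\<in>{U. open U \<and> A \<subseteq> U}. emeasure M U) \<le> emeasure M A + ennreal e" .
    qed
  qed
qed

text \<open>By Markov's inequality the superlevel sets \<open>{x. 1/n < w x}\<close> have finite measure. They are open
  because \<open>w\<close> is continuous and exhaust the space because \<open>w\<close> is positive.\<close>

lemma regular_borel_measure_if_finite_weight:
  fixes M :: "'a::{second_countable_topology, complete_space} measure" and w :: "'a \<Rightarrow> real"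
  assumes sM: "sets M = sets borel"
    and cont: "continuous_on UNIV w" and pos: "\<And>x. 0 < w x"
    and fin: "(\<integral>\<^sup>+x. ennreal (w x) \<partial>M) < \<infinity>"
  shows "regular_borel_measure M"
proof (rule regular_borel_measure_if_open_exhaustion[OF sM])
  note [measurable_cong] = sM
  have [measurable]: "w \<in> borel_measurable borel"
    using cont by (rule borel_measurable_continuous_onI)
  let ?W = "\<lambda>n::nat. {x. 1 < real n * w x}"
  show op: "open (?W n)" for n
    by (intro open_Collect_less continuous_intros cont)
  show "incseq ?W"
  proof (rule incseq_SucI, clarify)
    fix n x assume "1 < real n * w x"
    also have "\<dots> \<le> real (Suc n) * w x"
      using pos[of x] by (intro mult_right_mono) auto
    finally show "1 < real (Suc n) * w x" .
  qed
  show "(\<Union>n. ?W n) = UNIV"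
    using reals_Archimedean3[OF pos] by auto
  show "emeasure M (?W n) < \<infinity>" for n
  proof -
    have "emeasure M (?W n) = (\<integral>\<^sup>+x. indicator (?W n) x \<partial>M)"
      using op[of n] by (intro nn_integral_indicator[symmetric]) (simp add: sM)
    also have "\<dots> \<le> (\<integral>\<^sup>+x. ennreal (real n) * ennreal (w x) \<partial>M)"
    proof (rule nn_integral_mono)
      fix x
      show "indicator (?W n) x \<le> ennreal (real n) * ennreal (w x)"
        by (auto simp: indicator_def ennreal_mult'[symmetric] simp flip: ennreal_1 intro!: ennreal_leI)
    qed
    also have "\<dots> = ennreal (real n) * (\<integral>\<^sup>+x. ennreal (w x) \<partial>M)"
      by (intro nn_integral_cmult) measurable
    also have "\<dots> < \<infinity>"
      using fin by (simp add: ennreal_mult_less_top)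
    finally show ?thesis .
  qed
qed

theorem theorem11p1:
  fixes \<sigma>1 \<sigma>2 :: "(real ^ 'n) measure"
  assumes "\<sigma>1 \<in> class_C" and "\<sigma>2 \<in> class_Cb"
  shows "(\<sigma>1 \<star> \<sigma>2) \<in> class_C"
proof -
  define w :: "nat \<Rightarrow> real ^ 'n \<Rightarrow> real" where "w p x = 1 / (1 + (norm x)\<^sup>2) ^ p" for p x
  have base: "0 < 1 + (norm x)\<^sup>2" for x :: "real ^ 'n"
    by (simp add: add_pos_nonneg)
  have w_pos: "0 < w p x" for p x
    using base[of x] by (simp add: w_def)
  have w_cont: "continuous_on UNIV (w p)" for p
    unfolding w_def using base by (intro continuous_intros) (auto simp: less_imp_neq[symmetric])
  have w_meas [measurable]: "w p \<in> borel_measurable borel" for p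
    using w_cont by (rule borel_measurable_continuous_onI)
  have [measurable_cong]: "sets \<sigma>1 = sets borel" "sets \<sigma>2 = sets borel"
    using assms by (auto simp: class_C_def class_Cb_def regular_borel_measure_def)
  interpret S1: sigma_finite_measure \<sigma>1 by (rule sigma_finite_class_C[OF assms(1)])
  interpret S2: sigma_finite_measure \<sigma>2 by (rule sigma_finite_class_Cb[OF assms(2)])
  interpret pair_sigma_finite \<sigma>1 \<sigma>2 ..

  obtain p where p: "(\<integral>\<^sup>+u. ennreal (w p u) \<partial>\<sigma>1) < \<infinity>"
    using assms(1) by (auto simp: class_C_def w_def)
  obtain q C where C: "0 < C"
    and q: "\<And>u. (\<integral>\<^sup>+v. ennreal (w q (v + u)) \<partial>\<sigma>2) \<le> ennreal (C * w p u)"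
    using assms(2) unfolding class_Cb_def w_def by simp blast

  have "(\<integral>\<^sup>+x. ennreal (w q x) \<partial>(\<sigma>1 \<star> \<sigma>2)) = (\<integral>\<^sup>+v. \<integral>\<^sup>+u. ennreal (w q (u + v)) \<partial>\<sigma>1 \<partial>\<sigma>2)"
    by (rule nn_integral_convolution_class[OF assms]) measurable
  also have "\<dots> = (\<integral>\<^sup>+u. \<integral>\<^sup>+v. ennreal (w q (u + v)) \<partial>\<sigma>2 \<partial>\<sigma>1)"
    by (rule Fubini') measurable
  also have "\<dots> \<le> (\<integral>\<^sup>+u. ennreal C * ennreal (w p u) \<partial>\<sigma>1)"
    using q C w_pos[of p]
    by (intro nn_integral_mono) (simp add: add.commute ennreal_mult less_imp_le)
  also have "\<dots> = ennreal C * (\<integral>\<^sup>+u. ennreal (w p u) \<partial>\<sigma>1)"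
    by (intro nn_integral_cmult) measurable
  also have "\<dots> < \<infinity>"
    using p by (simp add: ennreal_mult_less_top)
  finally have fin: "(\<integral>\<^sup>+x. ennreal (w q x) \<partial>(\<sigma>1 \<star> \<sigma>2)) < \<infinity>" .
  have "regular_borel_measure (\<sigma>1 \<star> \<sigma>2)"
    by (rule regular_borel_measure_if_finite_weight[OF _ w_cont w_pos fin]) simp
  with fin show ?thesis
    by (auto simp: class_C_def w_def)
qed

end
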